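(* The relation $\equiv_1$ of $1$-equivalence on $2^\mathbb{N}$ is $\Pi^0_2$-graphable with diameter $2$.
   Context: Subsets of $\mathbb{N}$ are identified with elements of $2^\mathbb{N}$. $A\equiv_1 B$ means there is a computable bijection $f:\mathbb{N}\to\mathbb{N}$ with $n\in A\iff f(n)\in B$ for all $n$. An equivalence relation $E$ on a space $X$ is $\Gamma$-graphable (for a pointclass $\Gamma$, here lightface $\Pi^0_2$) if there is a simple undirected graph $G\subseteq X\times X$ in $\Gamma$ whose connectedness relation (connected by a finite path) equals $E$; it is $\Gamma$-graphable with diameter $k$ if such a $G$ exists in which $k$ is the least integer such that any two $G$-connected points are joined by a path of length at most $k$. *)

theory Defs
  imports Main
begin

datatype recf =
    Zero
  | Succ
  | Proj nat
  | Comp recf "recf list"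
  | Prim recf recf
  | Mn recf

inductive eval :: "recf \<Rightarrow> nat list \<Rightarrow> nat \<Rightarrow> bool" where
  eval_Zero: "eval Zero xs 0"
| eval_Succ: "eval Succ (x # xs) (Suc x)"
| eval_Proj: "i < length xs \<Longrightarrow> eval (Proj i) xs (xs ! i)"
| eval_Comp: "list_all2 (\<lambda>g y. eval g xs y) gs ys \<Longrightarrow> eval f ys z \<Longrightarrow> eval (Comp f gs) xs z"
| eval_Prim0: "eval f xs y \<Longrightarrow> eval (Prim f g) (0 # xs) y"
| eval_PrimS: "eval (Prim f g) (n # xs) y \<Longrightarrow> eval g (n # y # xs) z
      \<Longrightarrow> eval (Prim f g) (Suc n # xs) z"
| eval_Mn: "eval f (n # xs) 0 \<Longrightarrow> (\<forall>m<n. \<exists>y. eval f (m # xs) y \<and> 0 < y)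
      \<Longrightarrow> eval (Mn f) xs n"

definition computable :: "(nat \<Rightarrow> nat) \<Rightarrow> bool" where
  "computable f \<longleftrightarrow> (\<exists>c. \<forall>n. eval c [n] (f n))"

definition computable_rel4 :: "(nat \<Rightarrow> nat \<Rightarrow> nat \<Rightarrow> nat \<Rightarrow> bool) \<Rightarrow> bool" where
  "computable_rel4 R \<longleftrightarrow>
     (\<exists>c. \<forall>n m a b. eval c [n, m, a, b] (if R n m a b then 1 else 0))"

text \<open>Points of Cantor space 2^N are subsets of N. The initial segment of length m of A
  is coded by the natural number sum of 2^i over i in A with i < m.\<close>
definition prefix_code :: "nat set \<Rightarrow> nat \<Rightarrow> nat" where
  "prefix_code A m = (\<Sum>i\<in>{i. i < m \<and> i \<in> A}. 2 ^ i)"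

definition Pi02 :: "(nat set \<times> nat set) set \<Rightarrow> bool" where
  "Pi02 S \<longleftrightarrow> (\<exists>R. computable_rel4 R \<and>
     S = {(A, B). \<forall>n. \<exists>m. R n m (prefix_code A m) (prefix_code B m)})"

definition one_equiv :: "nat set \<Rightarrow> nat set \<Rightarrow> bool" where
  "one_equiv A B \<longleftrightarrow> (\<exists>f. computable f \<and> bij f \<and> (\<forall>n. n \<in> A \<longleftrightarrow> f n \<in> B))"

definition simple_graph :: "('a \<times> 'a) set \<Rightarrow> bool" where
  "simple_graph G \<longleftrightarrow> sym G \<and> irrefl G"

definition paths_bounded_by :: "('a \<times> 'a) set \<Rightarrow> nat \<Rightarrow> bool" where
  "paths_bounded_by G k \<longleftrightarrow> (\<forall>x y. (x, y) \<in> G\<^sup>* \<longrightarrow> (\<exists>j\<le>k. (x, y) \<in> G ^^ j))"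

definition has_diameter :: "('a \<times> 'a) set \<Rightarrow> nat \<Rightarrow> bool" where
  "has_diameter G k \<longleftrightarrow> paths_bounded_by G k \<and> (\<forall>j<k. \<not> paths_bounded_by G j)"

definition Pi02_graphable_with_diameter ::
    "(nat set \<times> nat set) set \<Rightarrow> nat \<Rightarrow> bool" where
  "Pi02_graphable_with_diameter E k \<longleftrightarrow>
     (\<exists>G. Pi02 G \<and> simple_graph G \<and> G\<^sup>* = E \<and> has_diameter G k)"

end

theory Submission
  imports Defs "HOL-Library.Nat_Bijection"
begin

text \<open>
  For a set \<open>A\<close> other than \<open>{}\<close> and \<open>UNIV\<close>, let \<open>n(A)\<close> be the least \<open>k\<close> such that \<open>A\<close> distinguishes
  \<open>k\<close> from \<open>0\<close>. Join \<open>A\<close> to \<open>B\<close> if \<open>n(A) < n(B) = k\<close> and some program with code at most \<open>k\<close>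
  computes a permutation taking \<open>A\<close> to \<open>B\<close>, up to a rearrangement of \<open>B\<close> below \<open>2k\<close>. Since \<open>k\<close>
  can be read off from \<open>B\<close>, the existential quantifiers over programs and rearrangements are
  bounded, so the graph is \<open>\<Pi>\<^sup>0\<^sub>2\<close>. If a computable permutation takes \<open>A\<close> to \<open>C\<close>, then \<open>A\<close> and \<open>C\<close>
  have a common neighbour: for every \<open>N\<close>, one of \<open>C\<close> and its complement has at least \<open>N\<close> elements
  below \<open>2N\<close>, so \<open>C\<close> can be rearranged below \<open>2N\<close> to a set \<open>B\<close> that is constant below \<open>N\<close>; this
  makes \<open>n(B)\<close> as large as desired. Sets with the same value of \<open>n\<close>, such as \<open>{0}\<close> and \<open>{1}\<close>, are
  never adjacent.
\<close>

section \<open>Closure properties of recursive functions\<close>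

text \<open>Environments are lists of fixed length; entries out of range are \<open>0\<close>, which makes \<open>arg_tl\<close>
  unconditional.\<close>

definition arg :: "nat \<Rightarrow> nat list \<Rightarrow> nat" where
  "arg i xs = (if i < length xs then xs ! i else 0)"

lemma arg_tl: "arg i (tl xs) = arg (Suc i) xs"
  by (cases xs) (auto simp: arg_def)

lemma arg_Cons [simp]: "arg 0 (x # xs) = x" "arg (Suc i) (x # xs) = arg i xs"
  by (auto simp: arg_def)

text \<open>Correctness is demanded only on lists of length \<open>k\<close>, so a function may be
  written with total list operations such as \<open>arg\<close> and \<open>tl\<close>. Predicates
  enter through their characteristic functions.\<close>

definition rf :: "nat \<Rightarrow> (nat list \<Rightarrow> nat) \<Rightarrow> bool" where
  "rf k f \<longleftrightarrow> (\<exists>c. \<forall>xs. length xs = k \<longrightarrow> eval c xs (f xs))"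

abbreviation rfp :: "nat \<Rightarrow> (nat list \<Rightarrow> bool) \<Rightarrow> bool" where
  "rfp k P \<equiv> rf k (\<lambda>xs. of_bool (P xs))"

lemma rf_cong: "rf k f \<Longrightarrow> (\<And>xs. length xs = k \<Longrightarrow> f xs = g xs) \<Longrightarrow> rf k g"
  unfolding rf_def by metis

lemma rf_arg: "i < k \<Longrightarrow> rf k (arg i)"
  unfolding rf_def arg_def by (rule exI[of _ "Proj i"]) (auto intro: eval_Proj)

lemma rf_Comp:
  assumes "rf (length fs) g" "\<forall>f\<in>set fs. rf k f"
  shows "rf k (\<lambda>xs. g (map (\<lambda>f. f xs) fs))"
proof -
  obtain c where c: "\<And>xs. length xs = length fs \<Longrightarrow> eval c xs (g xs)"
    using assms(1) unfolding rf_def by blast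
  obtain d where d: "\<And>f xs. f \<in> set fs \<Longrightarrow> length xs = k \<Longrightarrow> eval (d f) xs (f xs)"
    using assms(2) unfolding rf_def by metis
  have "eval (Comp c (map d fs)) xs (g (map (\<lambda>f. f xs) fs))" if "length xs = k" for xs
    using that by (intro eval_Comp[OF _ c]) (auto simp: list.rel_map list_all2_same d)
  then show ?thesis unfolding rf_def by blast
qed

lemma rf_Comp1:
  assumes "rf (Suc 0) (\<lambda>xs. h (arg 0 xs))" "rf k f"
  shows "rf k (\<lambda>xs. h (f xs))"
  using rf_Comp[of "[f]" "\<lambda>xs. h (arg 0 xs)" k] assms by simp

lemma rf_Comp2:
  assumes "rf (Suc (Suc 0)) (\<lambda>xs. h (arg 0 xs) (arg (Suc 0) xs))" "rf k f" "rf k g"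
  shows "rf k (\<lambda>xs. h (f xs) (g xs))"
  using rf_Comp[of "[f, g]" "\<lambda>xs. h (arg 0 xs) (arg (Suc 0) xs)" k] assms by simp

lemma rf_Comp4:
  assumes "rf (Suc (Suc (Suc (Suc 0))))
      (\<lambda>xs. h (arg 0 xs) (arg (Suc 0) xs) (arg (Suc (Suc 0)) xs) (arg (Suc (Suc (Suc 0))) xs))"
    "rf k f1" "rf k f2" "rf k f3" "rf k f4"
  shows "rf k (\<lambda>xs. h (f1 xs) (f2 xs) (f3 xs) (f4 xs))"
  using rf_Comp[of "[f1, f2, f3, f4]" "\<lambda>xs. h (arg 0 xs) (arg (Suc 0) xs) (arg (Suc (Suc 0)) xs)
      (arg (Suc (Suc (Suc 0))) xs)" k] assms
  by simp

lemma rf_Suc: "rf k f \<Longrightarrow> rf k (\<lambda>xs. Suc (f xs))"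
proof (rule rf_Comp1[where h = Suc])
  have "eval Succ xs (Suc (arg 0 xs))" if "length xs = Suc 0" for xs
    using that eval_Succ by (cases xs) auto
  then show "rf (Suc 0) (\<lambda>xs. Suc (arg 0 xs))" unfolding rf_def by blast
qed

lemma rf_const: "rf k (\<lambda>xs. n)"
proof (induction n)
  case 0
  then show ?case unfolding rf_def by (blast intro: eval_Zero)
next
  case (Suc n)
  then show ?case by (rule rf_Suc)
qed

lemma list_all2_eval_Proj:
  "\<forall>i\<in>set is. i < length xs \<Longrightarrow>
    list_all2 (\<lambda>g y. eval g xs y) (map Proj is) (map (\<lambda>i. arg i xs) is)"
  by (auto simp: list.rel_map list_all2_same arg_def intro: eval_Proj)

lemma map_arg_upt: "map (\<lambda>i. arg i xs) [m..<length xs] = drop m xs"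
  by (rule nth_equalityI) (auto simp: arg_def)

lemma rf_select:
  assumes "rf (length is) f" "\<forall>i\<in>set is. i < k"
  shows "rf k (\<lambda>xs. f (map (\<lambda>i. arg i xs) is))"
  using rf_Comp[of "map arg is" f k] assms by (simp add: rf_arg comp_def)

lemma rf_tl: assumes "rf k f" shows "rf (Suc k) (\<lambda>xs. f (tl xs))"
proof (rule rf_cong)
  show "rf (Suc k) (\<lambda>xs. f (map (\<lambda>i. arg i xs) [1..<Suc k]))"
    by (rule rf_select) (use assms in \<open>auto simp del: upt_Suc\<close>)
  show "f (map (\<lambda>i. arg i xs) [1..<Suc k]) = f (tl xs)" if "length xs = Suc k" for xs
    using map_arg_upt[of xs 1] that by (simp add: drop_Suc del: upt_Suc)
qed

text \<open>Newly bound values are pushed to the front of the environment and the parameters are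
  reached through \<open>tl\<close>, as with de Bruijn indices. Since \<open>arg_tl\<close>
  renumbers the variables, closure proofs become plain rule application.\<close>

lemma rf_rec:
  assumes "rf k f" "rf (Suc (Suc k)) (\<lambda>ys. g (arg 0 ys) (arg (Suc 0) ys) (tl (tl ys)))" "rf k b"
  shows "rf k (\<lambda>xs. rec_nat (f xs) (\<lambda>n y. g n y xs) (b xs))"
proof -
  obtain cf where cf: "\<And>xs. length xs = k \<Longrightarrow> eval cf xs (f xs)"
    using assms(1) unfolding rf_def by blast
  obtain cg where cg: "\<And>xs. length xs = Suc (Suc k) \<Longrightarrow>
      eval cg xs (g (arg 0 xs) (arg (Suc 0) xs) (tl (tl xs)))"
    using assms(2) unfolding rf_def by blast
  obtain cb where cb: "\<And>xs. length xs = k \<Longrightarrow> eval cb xs (b xs)"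
    using assms(3) unfolding rf_def by blast
  have rec: "eval (Prim cf cg) (n # xs) (rec_nat (f xs) (\<lambda>n y. g n y xs) n)"
    if "length xs = k" for n xs
  proof (induction n)
    case 0
    then show ?case using cf[OF that] by (auto intro: eval_Prim0)
  next
    case (Suc n)
    let ?y = "rec_nat (f xs) (\<lambda>n y. g n y xs) n"
    from cg[of "n # ?y # xs"] that have "eval cg (n # ?y # xs) (g n ?y xs)" by simp
    with Suc show ?case by (auto intro: eval_PrimS)
  qed
  \<comment> \<open>\<open>Prim\<close> recurses on its first argument, so the value of
    \<open>b\<close> is placed in front of the original arguments.\<close>
  have "eval (Comp (Prim cf cg) (cb # map Proj [0..<k])) xs
      (rec_nat (f xs) (\<lambda>n y. g n y xs) (b xs))" if "length xs = k" for xs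
    using that cb[OF that] list_all2_eval_Proj[of "[0..<k]" xs] map_arg_upt[of xs 0]
    by (intro eval_Comp[OF _ rec]) auto
  then show ?thesis unfolding rf_def by blast
qed

text \<open>The existence of a zero makes the search total; minimality supplies the positive earlier
  values that \<open>eval_Mn\<close> demands.\<close>

lemma rf_Least:
  assumes "rf (Suc k) (\<lambda>ys. g (arg 0 ys) (tl ys))" "\<And>xs. \<exists>n. g n xs = 0"
  shows "rf k (\<lambda>xs. LEAST n. g n xs = 0)"
proof -
  obtain c where c: "\<And>xs. length xs = Suc k \<Longrightarrow> eval c xs (g (arg 0 xs) (tl xs))"
    using assms(1) unfolding rf_def by blast
  have "eval (Mn c) xs (LEAST n. g n xs = 0)" if "length xs = k" for xs
  proof (rule eval_Mn)
    have "g (LEAST n. g n xs = 0) xs = 0" using assms(2) by (metis (mono_tags) LeastI)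
    with c[of "(LEAST n. g n xs = 0) # xs"] that
    show "eval c ((LEAST n. g n xs = 0) # xs) 0" by simp
    show "\<forall>m<(LEAST n. g n xs = 0). \<exists>y. eval c (m # xs) y \<and> 0 < y"
    proof (intro allI impI exI conjI)
      fix m assume "m < (LEAST n. g n xs = 0)"
      then show "0 < g m xs" using not_less_Least by blast
      show "eval c (m # xs) (g m xs)" using c[of "m # xs"] that by simp
    qed
  qed
  then show ?thesis unfolding rf_def by blast
qed

section \<open>Arithmetic by primitive recursion\<close>

lemma rf_add: assumes "rf k f" "rf k g" shows "rf k (\<lambda>xs. f xs + g xs)"
proof -
  have "rf k (\<lambda>xs. rec_nat (f xs) (\<lambda>n y. Suc y) (g xs))"
    by (intro rf_rec rf_Suc rf_arg assms) simp
  moreover have "rec_nat a (\<lambda>n y. Suc y) b = a + b" for a b :: nat by (induction b) auto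
  ultimately show ?thesis by simp
qed


lemma rf_mult: assumes "rf k f" "rf k g" shows "rf k (\<lambda>xs. f xs * g xs)"
proof -
  have "rf k (\<lambda>xs. rec_nat 0 (\<lambda>n y. y + f xs) (g xs))"
    by (intro rf_rec rf_add rf_const rf_arg rf_tl assms) simp
  moreover have "rec_nat 0 (\<lambda>n y. y + a) b = a * b" for a b :: nat by (induction b) auto
  ultimately show ?thesis by simp
qed

lemma rf_power: assumes "rf k f" shows "rf k (\<lambda>xs. 2 ^ f xs)"
proof -
  have "rf k (\<lambda>xs. rec_nat 1 (\<lambda>n y. 2 * y) (f xs))"
    by (intro rf_rec rf_mult rf_const rf_arg rf_tl assms) simp
  moreover have "rec_nat 1 (\<lambda>n y. 2 * y) b = (2 :: nat) ^ b" for b by (induction b) auto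
  ultimately show ?thesis by simp
qed

lemma rf_diff: assumes "rf k f" "rf k g" shows "rf k (\<lambda>xs. f xs - g xs)"
proof -
  have pred: "rf k (\<lambda>xs. h xs - 1)" if "rf k h" for k h
  proof -
    have "rf k (\<lambda>xs. rec_nat 0 (\<lambda>n y. n) (h xs))"
      by (intro rf_rec rf_const rf_arg that) simp
    moreover have "rec_nat 0 (\<lambda>n y. n) b = b - 1" for b :: nat by (cases b) auto
    ultimately show ?thesis by simp
  qed
  have "rf k (\<lambda>xs. rec_nat (f xs) (\<lambda>n y. y - 1) (g xs))"
    by (intro rf_rec pred rf_arg assms) simp
  moreover have "rec_nat a (\<lambda>n y. y - 1) b = a - b" for a b :: nat by (induction b) auto
  ultimately show ?thesis by simp
qed

lemma rf_sum:
  assumes "rf k b" "rf (Suc k) (\<lambda>ys. f (arg 0 ys) (tl ys))"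
  shows "rf k (\<lambda>xs. \<Sum>i<b xs. f i xs)"
proof -
  \<comment> \<open>The step function of the recursion sees the running total in position 1;
    selecting positions 0 and 2 onwards hides it from \<open>f\<close>.\<close>
  have "rf (Suc (Suc k)) (\<lambda>ys. f (arg 0 ys) (tl (tl ys)))"
  proof (rule rf_cong)
    let ?h = "\<lambda>xs. map (\<lambda>i. arg i xs) (0 # [2..<Suc (Suc k)])"
    show "rf (Suc (Suc k)) (\<lambda>xs. f (arg 0 (?h xs)) (tl (?h xs)))"
      by (rule rf_select[of "0 # [2..<Suc (Suc k)]"]) (use assms in \<open>auto simp del: upt_Suc\<close>)
    show "f (arg 0 (?h xs)) (tl (?h xs)) = f (arg 0 xs) (tl (tl xs))"
      if "length xs = Suc (Suc k)" for xs
      using map_arg_upt[of xs 2] that by (simp add: drop_Suc numeral_2_eq_2 del: upt_Suc)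
  qed
  then have "rf k (\<lambda>xs. rec_nat 0 (\<lambda>n y. y + f n xs) (b xs))"
    by (intro rf_rec rf_add rf_const rf_arg assms) simp
  moreover have "rec_nat 0 (\<lambda>n y. y + f n xs) m = (\<Sum>i<m. f i xs)" for xs m
    by (induction m) auto
  ultimately show ?thesis by simp
qed

section \<open>Decidable predicates and bounded quantifiers\<close>

lemma rfp_not: assumes "rfp k P" shows "rfp k (\<lambda>xs. \<not> P xs)"
proof (rule rf_cong)
  show "rf k (\<lambda>xs. 1 - of_bool (P xs))" by (intro rf_diff rf_const assms)
qed simp

lemma rfp_and: "rfp k P \<Longrightarrow> rfp k Q \<Longrightarrow> rfp k (\<lambda>xs. P xs \<and> Q xs)"
  by (drule (1) rf_mult) (simp add: of_bool_conj)

lemma rfp_or: assumes "rfp k P" "rfp k Q" shows "rfp k (\<lambda>xs. P xs \<or> Q xs)"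
proof (rule rf_cong)
  show "rfp k (\<lambda>xs. \<not> (\<not> P xs \<and> \<not> Q xs))" by (intro rfp_not rfp_and assms)
qed simp

lemma rfp_imp: assumes "rfp k P" "rfp k Q" shows "rfp k (\<lambda>xs. P xs \<longrightarrow> Q xs)"
proof (rule rf_cong)
  show "rfp k (\<lambda>xs. \<not> P xs \<or> Q xs)" by (intro rfp_not rfp_or assms)
qed auto

lemma rfp_le: assumes "rf k f" "rf k g" shows "rfp k (\<lambda>xs. f xs \<le> g xs)"
proof (rule rf_cong)
  show "rf k (\<lambda>xs. 1 - (f xs - g xs))" by (intro rf_diff rf_const assms)
qed auto

lemma rfp_less: "rf k f \<Longrightarrow> rf k g \<Longrightarrow> rfp k (\<lambda>xs. f xs < g xs)"
  using rfp_le[OF rf_Suc, of k f g] by (simp add: Suc_le_eq)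

lemma rfp_eq: "rf k f \<Longrightarrow> rf k g \<Longrightarrow> rfp k (\<lambda>xs. f xs = g xs)"
  using rfp_and[OF rfp_le rfp_le, of k f g g f] by (simp add: eq_iff)

lemma rfp_iff: "rfp k P \<Longrightarrow> rfp k Q \<Longrightarrow> rfp k (\<lambda>xs. P xs \<longleftrightarrow> Q xs)"
  by (drule (1) rfp_eq) (simp only: of_bool_eq_iff)

lemma rf_if:
  assumes "rfp k P" "rf k f" "rf k g"
  shows "rf k (\<lambda>xs. if P xs then f xs else g xs)"
proof (rule rf_cong)
  show "rf k (\<lambda>xs. of_bool (P xs) * f xs + of_bool (\<not> P xs) * g xs)"
    by (intro rf_add rf_mult rfp_not assms)
qed simp

lemma rfp_ex:
  assumes "rf k b" "rfp (Suc k) (\<lambda>ys. P (arg 0 ys) (tl ys))"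
  shows "rfp k (\<lambda>xs. \<exists>i<b xs. P i xs)"
proof (rule rf_cong)
  show "rfp k (\<lambda>xs. 0 < (\<Sum>i<b xs. of_bool (P i xs) :: nat))"
    by (intro rfp_less rf_const rf_sum assms)
  have "(\<exists>i<n. P i xs) \<longleftrightarrow> 0 < (\<Sum>i<n. of_bool (P i xs) :: nat)" for n xs
    by (induction n) (auto simp: less_Suc_eq)
  then show "of_bool (0 < (\<Sum>i<b xs. of_bool (P i xs) :: nat)) = of_bool (\<exists>i<b xs. P i xs)" for xs
    by simp
qed

lemma rfp_all:
  assumes "rf k b" "rfp (Suc k) (\<lambda>ys. P (arg 0 ys) (tl ys))"
  shows "rfp k (\<lambda>xs. \<forall>i<b xs. P i xs)"
proof (rule rf_cong)
  show "rfp k (\<lambda>xs. \<not> (\<exists>i<b xs. \<not> P i xs))" by (intro rfp_not rfp_ex assms)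
qed simp

lemmas rf_arith = rf_const rf_Suc rf_add rf_mult rf_diff rf_power rfp_not rfp_and rfp_or rfp_imp
  rfp_le rfp_less rfp_eq rfp_iff rf_if

lemma rf_prod_encode: "rf k f \<Longrightarrow> rf k g \<Longrightarrow> rf k (\<lambda>xs. prod_encode (f xs, g xs))"
proof -
  have "triangle n = (\<Sum>i<n. Suc i)" for n by (induction n) auto
  moreover assume "rf k f" "rf k g"
  then have "rf k (\<lambda>xs. (\<Sum>i<f xs + g xs. Suc i) + f xs)"
    by (intro rf_sum rf_add rf_Suc rf_arg) auto
  ultimately show ?thesis by (simp add: prod_encode_def)
qed

text \<open>Oddness of \<open>w div 2 ^ j\<close> is restated through a quotient \<open>q\<close>
  and a remainder \<open>r\<close>, both bounded, which brings the bit test under the rules for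
  bounded quantifiers.\<close>

lemma rfp_set_decode: "rf k f \<Longrightarrow> rf k g \<Longrightarrow> rfp k (\<lambda>xs. f xs \<in> set_decode (g xs))"
proof -
  have *: "j \<in> set_decode w \<longleftrightarrow> (\<exists>q<Suc w. \<exists>r<2 ^ j. w = Suc (2 * q) * 2 ^ j + r)" for j w
  proof
    assume "j \<in> set_decode w"
    then have "odd (w div 2 ^ j)" by (simp add: set_decode_def)
    then obtain q where q: "w div 2 ^ j = Suc (2 * q)" by (auto elim: oddE)
    have "w = Suc (2 * q) * 2 ^ j + w mod 2 ^ j" by (metis q div_mult_mod_eq)
    moreover have "q < Suc w" using q div_le_dividend[of w "2 ^ j"] by linarith
    moreover have "w mod 2 ^ j < 2 ^ j" by simp
    ultimately show "\<exists>q<Suc w. \<exists>r<2 ^ j. w = Suc (2 * q) * 2 ^ j + r"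
      by (intro exI conjI)
  next
    assume "\<exists>q<Suc w. \<exists>r<2 ^ j. w = Suc (2 * q) * 2 ^ j + r"
    then obtain q r where r: "r < 2 ^ j" and w: "w = Suc (2 * q) * 2 ^ j + r" by (elim exE conjE)
    have "w div 2 ^ j = Suc (2 * q)" unfolding w using r by (subst div_mult_self3) simp_all
    then show "j \<in> set_decode w" by (simp add: set_decode_def)
  qed
  assume "rf k f" "rf k g"
  then show ?thesis
  proof (rule rf_Comp2[where h = "\<lambda>j w. of_bool (j \<in> set_decode w)", rotated])
    show "rfp (Suc (Suc 0)) (\<lambda>xs. arg 0 xs \<in> set_decode (arg (Suc 0) xs))"
      unfolding * by (rule rfp_ex rf_arith rf_arg | simp add: arg_tl)+
  qed
qed

section \<open>Finite certificates for evaluation\<close>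

function dec :: "nat \<Rightarrow> recf" where
  "dec e = (case prod_decode e of (t, r) \<Rightarrow>
     if t = 1 then Succ
     else if t = 2 then Proj r
     else if t = 3 then (case prod_decode r of (f, gs) \<Rightarrow> Comp (dec f) (map dec (list_decode gs)))
     else if t = 4 then (case prod_decode r of (f, g) \<Rightarrow> Prim (dec f) (dec g))
     else if t = 5 then Mn (dec r)
     else Zero)"
  by auto

text \<open>Every constructor with components has a positive tag, so component codes are strictly
  smaller. This gives termination of \<open>dec\<close> and drives the induction on codes in the
  soundness proof.\<close>

lemma prod_encode_less: "0 < t \<Longrightarrow> r < prod_encode (t, r)"
  using le_prod_encode_2[of r t] by (cases t) (auto simp: prod_encode_def)

lemma list_encode_ge: "x \<in> set xs \<Longrightarrow> x \<le> list_encode xs"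
proof (induction xs)
  case (Cons a xs)
  then show ?case
    using le_prod_encode_1[of a "list_encode xs"] le_prod_encode_2[of "list_encode xs" a] by auto
qed simp

lemma list_decode_le: "x \<in> set (list_decode n) \<Longrightarrow> x \<le> n"
  using list_encode_ge[of x "list_decode n"] by simp

lemma prod_decode_less: "(t, r) = prod_decode e \<Longrightarrow> 0 < t \<Longrightarrow> r < e"
  using prod_encode_less[of t r] by simp

lemma prod_decode_le: "(a, b) = prod_decode r \<Longrightarrow> a \<le> r" "(a, b) = prod_decode r \<Longrightarrow> b \<le> r"
  using le_prod_encode_1[of a b] le_prod_encode_2[of b a] by simp_all

termination dec
  by (relation "measure id")
    (force dest: prod_decode_less prod_decode_le list_decode_le)+

declare dec.simps [simp del]

lemma dec_prod_encode [simp]: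
  "dec (prod_encode (0, r)) = Zero"
  "dec (prod_encode (1, r)) = Succ"
  "dec (prod_encode (2, r)) = Proj r"
  "dec (prod_encode (3, prod_encode (f, gs))) = Comp (dec f) (map dec (list_decode gs))"
  "dec (prod_encode (4, prod_encode (f, g))) = Prim (dec f) (dec g)"
  "dec (prod_encode (5, r)) = Mn (dec r)"
  by (simp_all add: dec.simps[of "prod_encode x" for x])

fun enc :: "recf \<Rightarrow> nat" where
  "enc Zero = prod_encode (0, 0)"
| "enc Succ = prod_encode (1, 0)"
| "enc (Proj i) = prod_encode (2, i)"
| "enc (Comp f gs) = prod_encode (3, prod_encode (enc f, list_encode (map enc gs)))"
| "enc (Prim f g) = prod_encode (4, prod_encode (enc f, enc g))"
| "enc (Mn f) = prod_encode (5, enc f)"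

lemma dec_enc [simp]: "dec (enc c) = c"
  by (induction c rule: enc.induct)
    (simp_all add: map_idI del: One_nat_def)

inductive_cases eval_ZeroE: "eval Zero xs y"
inductive_cases eval_SuccE: "eval Succ xs y"
inductive_cases eval_ProjE: "eval (Proj i) xs y"
inductive_cases eval_CompE: "eval (Comp f gs) xs y"
inductive_cases eval_Prim0E: "eval (Prim f g) (0 # xs) y"
inductive_cases eval_PrimSE: "eval (Prim f g) (Suc n # xs) y"
inductive_cases eval_MnE: "eval (Mn f) xs y"

text \<open>In the \<open>Mn\<close> case, two different results clash at the smaller one: there one
  derivation gives 0 and the other a positive value.\<close>

lemma eval_functional: "eval c xs y \<Longrightarrow> eval c xs z \<Longrightarrow> y = z"
proof (induction arbitrary: z rule: eval.induct)
  case (eval_Comp xs gs ys f y)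
  from eval_Comp.prems obtain ys' where
    ys': "list_all2 (\<lambda>g y. eval g xs y) gs ys'" "eval f ys' z"
    by (auto elim: eval_CompE)
  have "ys = ys'"
    using eval_Comp.IH(1) ys'(1)
    by (auto simp: list_all2_conv_all_nth intro!: nth_equalityI)
  with eval_Comp.IH ys'(2) show ?case by blast
next
  case (eval_PrimS f g n xs y z')
  from eval_PrimS.prems obtain v where "eval (Prim f g) (n # xs) v" "eval g (n # v # xs) z"
    by (auto elim: eval_PrimSE)
  with eval_PrimS.IH show ?case by blast
next
  case (eval_Mn f n xs)
  from eval_Mn.prems have z: "eval f (z # xs) 0" "\<forall>m<z. \<exists>y. eval f (m # xs) y \<and> 0 < y"
    by (auto elim: eval_MnE)
  show ?case
  proof (rule linorder_cases)
    assume "n < z"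
    with z eval_Mn.IH(1) show ?thesis by (metis less_not_refl)
  next
    assume "z < n"
    with z eval_Mn.IH(2) show ?thesis by (metis less_not_refl)
  qed
next
  case (eval_Prim0 f xs y g)
  from eval_Prim0.prems have "eval f xs z" by (auto elim: eval_Prim0E)
  with eval_Prim0.IH show ?case by blast
qed (blast elim: eval_ZeroE eval_SuccE eval_ProjE)+

text \<open>A judgement \<open>(e, x, y)\<close> says that the program coded by \<open>e\<close> maps the list coded by \<open>x\<close> to \<open>y\<close>;
  a list judgement evaluates a list of programs. Parity keeps the codes of the two kinds apart.\<close>

definition judgement :: "nat \<Rightarrow> nat \<Rightarrow> nat \<Rightarrow> nat" where
  "judgement e x y = 2 * prod_encode (e, prod_encode (x, y))"

definition list_judgement :: "nat \<Rightarrow> nat \<Rightarrow> nat \<Rightarrow> nat" where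
  "list_judgement gs x ys = Suc (2 * prod_encode (gs, prod_encode (x, ys)))"

text \<open>The bound \<open>b\<close> on the witnesses only serves to make the relation decidable. A set all of whose
  judgements are justified within the set certifies them although no order of derivation is
  recorded: each rule leads to a subprogram or to a smaller recursion argument.\<close>

definition justified :: "nat \<Rightarrow> nat set \<Rightarrow> nat \<Rightarrow> nat \<Rightarrow> nat \<Rightarrow> bool" where
  "justified b W e x y \<longleftrightarrow> (\<exists>t<b. \<exists>r<b. e = prod_encode (t, r) \<and>
    (t = 0 \<and> y = 0 \<or>
     t = 1 \<and> (\<exists>h<b. \<exists>l<b. x = Suc (prod_encode (h, l)) \<and> y = Suc h) \<or>
     t = 2 \<and> (\<exists>h<b. \<exists>l<b. x = Suc (prod_encode (h, l)) \<and>
       (r = 0 \<and> y = h \<or> (\<exists>i<b. r = Suc i \<and> judgement (prod_encode (2, i)) l y \<in> W))) \<or>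
     t = 3 \<and> (\<exists>f<b. \<exists>gs<b. \<exists>ys<b. r = prod_encode (f, gs) \<and> list_judgement gs x ys \<in> W \<and>
         judgement f ys y \<in> W) \<or>
     t = 4 \<and> (\<exists>f<b. \<exists>g<b. \<exists>n<b. \<exists>l<b. r = prod_encode (f, g) \<and> x = Suc (prod_encode (n, l)) \<and>
       (n = 0 \<and> judgement f l y \<in> W \<or>
        (\<exists>m<b. \<exists>v<b. n = Suc m \<and> judgement e (Suc (prod_encode (m, l))) v \<in> W \<and>
          judgement g (Suc (prod_encode (m, Suc (prod_encode (v, l))))) y \<in> W))) \<or>
     t = 5 \<and> judgement r (Suc (prod_encode (y, x))) 0 \<in> W \<and>
       (\<forall>m<y. \<exists>v<b. 0 < v \<and> judgement r (Suc (prod_encode (m, x))) v \<in> W)))"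

definition justified_list :: "nat \<Rightarrow> nat set \<Rightarrow> nat \<Rightarrow> nat \<Rightarrow> nat \<Rightarrow> bool" where
  "justified_list b W gs x ys \<longleftrightarrow> gs = 0 \<and> ys = 0 \<or>
    (\<exists>g<b. \<exists>hs<b. \<exists>v<b. \<exists>vs<b. gs = Suc (prod_encode (g, hs)) \<and> ys = Suc (prod_encode (v, vs)) \<and>
      judgement g x v \<in> W \<and> list_judgement hs x vs \<in> W)"

definition self_justifying :: "nat \<Rightarrow> nat set \<Rightarrow> bool" where
  "self_justifying b W \<longleftrightarrow> (\<forall>e x y. (judgement e x y \<in> W \<longrightarrow> justified b W e x y) \<and>
      (list_judgement e x y \<in> W \<longrightarrow> justified_list b W e x y))"

lemma judgement_eq [simp]: "judgement e x y = judgement e' x' y' \<longleftrightarrow> e = e' \<and> x = x' \<and> y = y'"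
  "list_judgement e x y = list_judgement e' x' y' \<longleftrightarrow> e = e' \<and> x = x' \<and> y = y'"
  "judgement e x y \<noteq> list_judgement e' x' y'" "list_judgement e' x' y' \<noteq> judgement e x y"
  by (auto simp: judgement_def list_judgement_def) presburger+

text \<open>Membership in \<open>W\<close> occurs only positively, and \<open>b\<close> bounds only
  existential quantifiers; the universal quantifier in the search case is bounded by
  \<open>y\<close> instead.\<close>

lemma justified_mono:
  assumes "b \<le> b'" "W \<subseteq> W'"
  shows "justified b W e x y \<longrightarrow> justified b' W' e x y"
      "justified_list b W e x y \<longrightarrow> justified_list b' W' e x y"
proof -
  have b: "n < b \<longrightarrow> n < b'" for n using assms by auto
  have W: "n \<in> W \<longrightarrow> n \<in> W'" for n using assms by auto
  show "justified b W e x y \<longrightarrow> justified b' W' e x y" unfolding justified_def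
    by (rule imp_refl b W ex_mono all_mono conj_mono disj_mono imp_mono)+
  show "justified_list b W e x y \<longrightarrow> justified_list b' W' e x y" unfolding justified_list_def
    by (rule imp_refl b W ex_mono all_mono conj_mono disj_mono imp_mono)+
qed

lemma self_justifying_Un: "self_justifying b W \<Longrightarrow> self_justifying b' W' \<Longrightarrow>
  self_justifying (max b b') (W \<union> W')"
  unfolding self_justifying_def
  using justified_mono[of b "max b b'" W "W \<union> W'"] justified_mono[of b' "max b b'" W' "W \<union> W'"]
  by (auto simp del: max_def)

section \<open>Soundness of certificates\<close>

text \<open>Soundness of the individual programs is a hypothesis, to be discharged by the induction
  on codes in \<open>self_justifying_sound\<close>.\<close>

lemma self_justifying_sound_list:
  assumes W: "self_justifying b W"
    and sound: "\<And>g x y. g \<in> set gs \<Longrightarrow> judgement g x y \<in> W \<Longrightarrow> eval (dec g) (list_decode x) y"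
  shows "list_judgement (list_encode gs) x y \<in> W \<Longrightarrow>
    list_all2 (\<lambda>c v. eval c (list_decode x) v) (map dec gs) (list_decode y)"
  using sound
proof (induction gs arbitrary: y)
  case Nil
  then have "justified_list b W 0 x y" using W by (auto simp: self_justifying_def)
  then have "y = 0" by (auto simp: justified_list_def)
  then show ?case by simp
next
  case (Cons g gs)
  have "justified_list b W (list_encode (g # gs)) x y"
    using W Cons.prems unfolding self_justifying_def by blast
  then obtain v vs where "y = Suc (prod_encode (v, vs))" "judgement g x v \<in> W"
      "list_judgement (list_encode gs) x vs \<in> W"
    by (auto simp: justified_list_def)
  with Cons show ?case by auto
qed

text \<open>Strong induction on the code \<open>e\<close>: justifications lead to smaller codes,
  except that primitive recursion refers back to \<open>e\<close> itself with a smaller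
  argument.\<close>

lemma self_justifying_sound:
  assumes W: "self_justifying b W" and "judgement e x y \<in> W"
  shows "eval (dec e) (list_decode x) y"
  using assms(2)
proof (induction e arbitrary: x y rule: less_induct)
  case (less e)
  have IH: "\<And>e' x y. e' < e \<Longrightarrow> judgement e' x y \<in> W \<Longrightarrow> eval (dec e') (list_decode x) y"
    using less.IH by blast
  have justified: "justified b W e x y" if "judgement e x y \<in> W" for x y using W that
      by (auto simp: self_justifying_def)
  obtain t r where e: "e = prod_encode (t, r)" by (metis prod.exhaust prod_decode_inverse)
  have r_less: "r < e" if "0 < t" using e prod_encode_less that by simp
  from justified[OF less.prems] consider "t = 0" | "t = 1" | "t = 2" | "t = 3" | "t = 4" | "t = 5"
    by (auto simp: justified_def e)
  then show ?case
  proof cases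
    assume "t = 0"
    with justified[OF less.prems] show ?thesis by (auto simp: justified_def e intro: eval_Zero)
  next
    assume t: "t = 1"
    with justified[OF less.prems] show ?thesis
      by (auto simp: justified_def e eval_Succ simp flip: One_nat_def)
  next
    assume t: "t = 2"
    from justified[OF less.prems] obtain h l where x: "x = Suc (prod_encode (h, l))"
      and disj: "r = 0 \<and> y = h \<or> (\<exists>i. r = Suc i \<and> judgement (prod_encode (2, i)) l y \<in> W)"
      unfolding justified_def e t by auto
    from disj show ?thesis
    proof (elim disjE exE conjE)
      assume "r = 0" "y = h"
      then show ?thesis using eval_Proj[of 0 "h # list_decode l"] by (simp add: e t x)
    next
      fix i assume i: "r = Suc i" "judgement (prod_encode (2, i)) l y \<in> W"
      \<comment> \<open>Passing to the tail of the list lowers the index and with it the code, so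
        the outer induction hypothesis applies.\<close>
      have "prod_encode (2, i) < e" by (simp add: e t i(1) prod_encode_def)
      from IH[OF this i(2)] have "eval (Proj i) (list_decode l) y" by simp
      then have "i < length (list_decode l)" "y = list_decode l ! i" by (auto elim: eval_ProjE)
      then show ?thesis using eval_Proj[of "Suc i" "h # list_decode l"] by (simp add: e t i(1) x)
    qed
  next
    assume t: "t = 3"
    from justified[OF less.prems] obtain f gs ys where r: "r = prod_encode (f, gs)"
      and l: "list_judgement gs x ys \<in> W" and f: "judgement f ys y \<in> W"
      unfolding justified_def e t by auto
    have le: "f \<le> r" "gs \<le> r" using r le_prod_encode_1 le_prod_encode_2 by auto
    have "eval (dec f) (list_decode ys) y" using IH f le r_less t by simp
    moreover have "list_all2 (\<lambda>c v. eval c (list_decode x) v) (map dec (list_decode gs))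
        (list_decode ys)"
    proof (rule self_justifying_sound_list[OF W])
      fix g x y assume "g \<in> set (list_decode gs)" "judgement g x y \<in> W"
      then show "eval (dec g) (list_decode x) y"
        using IH[of g x y] list_decode_le[of g gs] le r_less t by auto
    qed (simp add: l)
    ultimately show ?thesis by (auto simp: e t r intro: eval_Comp)
  next
    assume t: "t = 4"
    from justified[OF less.prems] obtain f g n l where r: "r = prod_encode (f, g)"
      and x: "x = Suc (prod_encode (n, l))"
      unfolding justified_def e t by auto
    have le: "f < e" "g < e"
      using r le_prod_encode_1[of f g] le_prod_encode_2[of g f] r_less t by auto
    \<comment> \<open>The code does not decrease between successive values of the recursion, hence
      an inner induction on \<open>n\<close>.\<close>
    have "eval (Prim (dec f) (dec g)) (n # list_decode l) y"
        if "judgement e (Suc (prod_encode (n, l))) y \<in> W"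
      for n y
      using that
    proof (induction n arbitrary: y)
      case 0
      from justified[OF 0] have "judgement f l y \<in> W" unfolding justified_def e t r by auto
      then show ?case using IH le by (auto intro: eval_Prim0)
    next
      case (Suc n)
      from justified[OF Suc.prems] obtain v where "judgement e (Suc (prod_encode (n, l))) v \<in> W"
        and g: "judgement g (Suc (prod_encode (n, Suc (prod_encode (v, l))))) y \<in> W"
        unfolding justified_def e t r by auto
      then have "eval (Prim (dec f) (dec g)) (n # list_decode l) v" using Suc.IH by blast
      moreover have "eval (dec g) (n # v # list_decode l) y" using IH[OF le(2) g] by simp
      ultimately show ?case by (rule eval_PrimS)
    qed
    from this[of n y] less.prems show ?thesis by (simp add: e t r x)
  next
    assume t: "t = 5"
    from justified[OF less.prems] have *: "judgement r (Suc (prod_encode (y, x))) 0 \<in> W"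
      "\<forall>m<y. \<exists>v. 0 < v \<and> judgement r (Suc (prod_encode (m, x))) v \<in> W"
      unfolding justified_def e t by auto
    have IHr: "eval (dec r) (m # list_decode x) v"
        if "judgement r (Suc (prod_encode (m, x))) v \<in> W" for m v
      using IH[OF r_less that] t by simp
    have "eval (Mn (dec r)) (list_decode x) y"
      using * by (intro eval_Mn) (blast intro: IHr)+
    then show ?thesis by (simp add: e t)
  qed
qed

section \<open>Completeness of certificates\<close>

definition derivable :: "nat \<Rightarrow> bool" where
  "derivable j \<longleftrightarrow> (\<exists>W b. finite W \<and> self_justifying b W \<and> j \<in> W)"

lemma derivable_finite:
  assumes "finite S" "\<forall>s\<in>S. derivable s"
  shows "\<exists>W b. finite W \<and> self_justifying b W \<and> S \<subseteq> W"
  using assms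
proof (induction S)
  case empty
  have "self_justifying 0 {}" by (simp add: self_justifying_def)
  then show ?case by blast
next
  case (insert s S)
  then obtain W b W' b' where "finite W" "self_justifying b W" "S \<subseteq> W" "finite W'"
      "self_justifying b' W'" "s \<in> W'"
    unfolding derivable_def by auto
  then have "finite (W \<union> W')" "self_justifying (max b b') (W \<union> W')" "insert s S \<subseteq> W \<union> W'"
    using self_justifying_Un by auto
  then show ?case by blast
qed

text \<open>Closure under one rule: the certificates of the premises are merged and the conclusion
  is inserted. By monotonicity all older judgements stay justified in the larger set.\<close>

lemma derivable_judgementI:
  assumes "finite S" "\<forall>s\<in>S. derivable s" "justified b S e x y"
  shows "derivable (judgement e x y)"
proof -
  obtain W b' where W: "finite W" "self_justifying b' W" "S \<subseteq> W"
    using derivable_finite[OF assms(1,2)] by blast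
  let ?W = "insert (judgement e x y) W" and ?b = "max b b'"
  have "S \<subseteq> ?W" using W(3) by blast
  then have "justified ?b ?W e x y" using justified_mono(1)[of b ?b S ?W] assms(3) by simp
  moreover have "justified b' W e x y \<longrightarrow> justified ?b ?W e x y"
      "justified_list b' W e x y \<longrightarrow> justified_list ?b ?W e x y" for e x y
    using justified_mono[OF _ subset_insertI, of b' ?b W] by simp_all
  ultimately have "self_justifying ?b ?W" using W(2) unfolding self_justifying_def by auto
  with W(1) show ?thesis unfolding derivable_def by blast
qed

lemma derivable_list_judgementI:
  assumes "finite S" "\<forall>s\<in>S. derivable s" "justified_list b S e x y"
  shows "derivable (list_judgement e x y)"
proof -
  obtain W b' where W: "finite W" "self_justifying b' W" "S \<subseteq> W"
    using derivable_finite[OF assms(1,2)] by blast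
  let ?W = "insert (list_judgement e x y) W" and ?b = "max b b'"
  have "S \<subseteq> ?W" using W(3) by blast
  then have "justified_list ?b ?W e x y" using justified_mono(2)[of b ?b S ?W] assms(3) by simp
  moreover have "justified b' W e x y \<longrightarrow> justified ?b ?W e x y"
      "justified_list b' W e x y \<longrightarrow> justified_list ?b ?W e x y" for e x y
    using justified_mono[OF _ subset_insertI, of b' ?b W] by simp_all
  ultimately have "self_justifying ?b ?W" using W(2) unfolding self_justifying_def by auto
  with W(1) show ?thesis unfolding derivable_def by blast
qed

text \<open>A projection is certified by walking down the list one element at a time, which is why
  the index carries the induction.\<close>

lemma derivable_Proj: "i < length xs \<Longrightarrow> derivable (judgement (prod_encode (2, i)) (list_encode xs)
  (xs ! i))"
proof (induction i arbitrary: xs)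
  case 0
  then obtain h l where "xs = h # l" by (cases xs) auto
  then show ?case
    by (intro derivable_judgementI[of "{}"
        "Suc (2 + h + list_encode l)"]) (simp_all add: justified_def)
next
  case (Suc i)
  then obtain h l where xs: "xs = h # l" by (cases xs) auto
  with Suc have "derivable (judgement (prod_encode (2, i)) (list_encode l) (l ! i))" by simp
  then show ?case
    by (intro derivable_judgementI[of "{judgement (prod_encode (2, i)) (list_encode l) (l ! i)}"
          "Suc (2 + h + list_encode l + Suc i)"])
      (simp_all add: justified_def xs)
qed

lemma derivable_list:
  "list_all2 (\<lambda>g y. derivable (judgement (enc g) x y)) gs ys \<Longrightarrow>
      derivable (list_judgement (list_encode (map enc gs)) x (list_encode ys))"
proof (induction rule: list_all2_induct)
  case Nil
  then show ?case by (intro derivable_list_judgementI[of "{}" 0]) (simp_all add: justified_list_def)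
next
  case (Cons g gs y ys)
  then show ?case
    by (intro derivable_list_judgementI[of "{judgement (enc g) x y, list_judgement (list_encode
        (map enc gs)) x (list_encode ys)}"
          "Suc (enc g + list_encode (map enc gs) + y + list_encode ys)"])
      (simp_all add: justified_list_def)
qed

text \<open>The explicit bounds are sums chosen to exceed every witness in the corresponding clause:
  tag, components, arguments and intermediate values.\<close>

lemma eval_derivable: "eval c xs y \<Longrightarrow> derivable (judgement (enc c) (list_encode xs) y)"
proof (induction rule: eval.induct)
  case (eval_Zero xs)
  show ?case by (intro derivable_judgementI[of "{}" 1]) (simp_all add: justified_def)
next
  case (eval_Succ x xs)
  show ?case by (intro derivable_judgementI[of "{}"
      "Suc (1 + x + list_encode xs)"]) (simp_all add: justified_def)
next
  case (eval_Proj i xs)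
  then show ?case using derivable_Proj by simp
next
  case (eval_Comp xs gs ys f z)
  let ?gs = "list_encode (map enc gs)"
  have "derivable (list_judgement ?gs (list_encode xs) (list_encode ys))"
    by (rule derivable_list) (use eval_Comp.IH(1) in \<open>auto elim: list_all2_mono\<close>)
  with eval_Comp.IH(2) show ?case
    by (intro derivable_judgementI[of "{list_judgement ?gs (list_encode xs) (list_encode ys),
        judgement (enc f) (list_encode ys) z}"
          "Suc (3 + prod_encode (enc f, ?gs) + enc f + ?gs + list_encode ys)"])
      (auto simp: justified_def)
next
  case (eval_Prim0 f xs y g)
  then show ?case
    by (intro derivable_judgementI[of "{judgement (enc f) (list_encode xs) y}"
          "Suc (4 + prod_encode (enc f, enc g) + enc f + enc g + list_encode xs)"])
      (auto simp: justified_def)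
next
  case (eval_PrimS f g n xs y z)
  let ?S = "{judgement (enc (Prim f g)) (list_encode (n # xs)) y, judgement (enc g) (list_encode
      (n # y # xs)) z}"
  have "justified (Suc (4 + prod_encode (enc f, enc g) + enc f + enc g + list_encode xs + Suc n +
      y)) ?S
      (enc (Prim f g)) (list_encode (Suc n # xs)) z"
    by (simp add: justified_def) (rule exI[of _ n], simp, rule exI[of _ y], simp)
  then show ?case by (rule derivable_judgementI[rotated 2]) (use eval_PrimS.IH in auto)
next
  case (eval_Mn f n xs)
  \<comment> \<open>The chosen values \<open>v m\<close> for \<open>m < n\<close> form a finite
    family, so finitely many premises suffice and \<open>sum v {..<n}\<close> bounds all the
    values.\<close>
  from eval_Mn.IH(2) obtain v where
    v: "\<And>m. m < n \<Longrightarrow> derivable (judgement (enc f) (list_encode (m # xs)) (v m)) \<and> 0 < v m"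
    by metis
  let ?S = "insert (judgement (enc f) (list_encode (n # xs)) 0)
    ((\<lambda>m. judgement (enc f) (list_encode (m # xs)) (v m)) ` {..<n})"
  have le: "v m < 6 + (enc f + sum v {..<n})" if "m < n" for m
    using member_le_sum[of m "{..<n}" v] that by simp
  have "justified (Suc (5 + enc f + sum v {..<n})) ?S (enc (Mn f)) (list_encode xs) n"
    using v le unfolding justified_def by (auto intro!: exI[of _ "v m" for m])
  then show ?case
    by (rule derivable_judgementI[rotated 2]) (use v eval_Mn.IH(1) in auto)
qed

text \<open>This plays the role of Kleene's T predicate: the stage \<open>s\<close> bounds both the
  code \<open>w\<close> of the certificate and the witnesses inside it.
  \<open>Suc (prod_encode (x, 0))\<close> is the code of the list \<open>[x]\<close>.\<close>

definition eval_within :: "nat \<Rightarrow> nat \<Rightarrow> nat \<Rightarrow> nat \<Rightarrow> bool" where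
  "eval_within s e x y \<longleftrightarrow> (\<exists>w<s. self_justifying s (set_decode w) \<and>
      judgement e (Suc (prod_encode (x, 0))) y \<in> set_decode w)"

lemma eval_within_mono: "eval_within s e x y \<Longrightarrow> s \<le> s' \<Longrightarrow> eval_within s' e x y"
  unfolding eval_within_def self_justifying_def
      by (meson justified_mono order.refl order.strict_trans2)

lemma eval_within_sound: "eval_within s e x y \<Longrightarrow> eval (dec e) [x] y"
  unfolding eval_within_def using self_justifying_sound[of s _ e "Suc (prod_encode (x, 0))" y]
      by auto

lemma eval_within_complete:
  assumes "eval c [x] y"
  shows "\<exists>s. eval_within s (enc c) x y"
proof -
  obtain W b where W: "finite W" "self_justifying b W"
      "judgement (enc c) (Suc (prod_encode (x, 0))) y \<in> W"
    using eval_derivable[OF assms] unfolding derivable_def by auto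
  let ?s = "max b (Suc (set_encode W))"
  have "self_justifying ?s W" using W(2) justified_mono[of b ?s W W] unfolding self_justifying_def
      by auto
  with W have "eval_within ?s (enc c) x y" unfolding eval_within_def
      by (intro exI[of _ "set_encode W"]) auto
  then show ?thesis by blast
qed

section \<open>Decidability of bounded evaluation\<close>

lemma set_decode_less: "j \<in> set_decode w \<Longrightarrow> j < w"
proof -
  assume "j \<in> set_decode w"
  then have "2 ^ j \<le> w" by (auto simp: set_decode_def intro: ccontr)
  then show ?thesis using less_exp[of j] by linarith
qed

lemma judgement_mem_less:
  assumes "judgement e x y \<in> set_decode w \<or> list_judgement e x y \<in> set_decode w"
  shows "e < w" "x < w" "y < w"
proof -
  have "prod_encode (e, prod_encode (x, y)) < w"
    using assms set_decode_less unfolding judgement_def list_judgement_def by fastforce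
  then show "e < w" "x < w" "y < w"
    using le_prod_encode_1[of e "prod_encode (x, y)"] le_prod_encode_2[of "prod_encode (x, y)" e]
      le_prod_encode_1[of x y] le_prod_encode_2[of y x] by linarith+
qed

text \<open>A judgement belonging to the set coded by \<open>w\<close> has all its components below
  \<open>w\<close>, so the unbounded quantifiers become bounded and the property decidable.\<close>

lemma self_justifying_set_decode_iff:
  "self_justifying b (set_decode w) \<longleftrightarrow> (\<forall>e<w. \<forall>x<w. \<forall>y<w.
    (judgement e x y \<in> set_decode w \<longrightarrow> justified b (set_decode w) e x y) \<and>
    (list_judgement e x y \<in> set_decode w \<longrightarrow> justified_list b (set_decode w) e x y))"
  unfolding self_justifying_def using judgement_mem_less by blast

lemmas rf_intros = rfp_ex rfp_all rf_arith rfp_set_decode rf_prod_encode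

lemma rfp_eval_within:
  assumes "rf k f1" "rf k f2" "rf k f3" "rf k f4"
  shows "rfp k (\<lambda>xs. eval_within (f1 xs) (f2 xs) (f3 xs) (f4 xs))"
proof (rule rf_Comp4[where h = "\<lambda>s e x y. of_bool (eval_within s e x y)", OF _ assms])
  show "rfp (Suc (Suc (Suc (Suc 0)))) (\<lambda>xs. eval_within (arg 0 xs) (arg (Suc 0) xs) (arg (Suc (Suc
      0)) xs)
      (arg (Suc (Suc (Suc 0))) xs))"
    unfolding eval_within_def self_justifying_set_decode_iff justified_def justified_list_def
        judgement_def list_judgement_def
    by (rule rf_intros | (rule rf_arg, simp; fail) | (simp only: arg_tl; fail) | simp only: arg_tl)+
qed

section \<open>Neighbours in the graph\<close>

lemma computable_iff: "computable f \<longleftrightarrow> rf (Suc 0) (\<lambda>xs. f (arg 0 xs))"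
proof -
  have "(\<forall>n. eval c [n] (f n)) \<longleftrightarrow> (\<forall>xs. length xs = Suc 0 \<longrightarrow> eval c xs (f (arg 0 xs)))" for c
    by (auto simp: length_Suc_conv)
  then show ?thesis by (simp add: computable_def rf_def)
qed

lemma computable_comp: "computable f \<Longrightarrow> computable g \<Longrightarrow> computable (g \<circ> f)"
  unfolding computable_iff comp_def by (rule rf_Comp1[where h = g])

text \<open>The preimage is found by unbounded search, which terminates by surjectivity.\<close>

lemma computable_inv:
  assumes "computable f" "bij f"
  shows "computable (inv f)"
proof -
  have f: "rf (Suc (Suc 0)) (\<lambda>ys. f (arg 0 ys))"
    by (rule rf_Comp1[where h = f]) (use assms in \<open>auto simp: computable_iff intro: rf_arg\<close>)
  have "rf (Suc 0) (\<lambda>xs. LEAST n. of_bool (f n \<noteq> arg 0 xs) = (0 :: nat))"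
  proof (rule rf_Least)
    show "rfp (Suc (Suc 0)) (\<lambda>ys. f (arg 0 ys) \<noteq> arg 0 (tl ys))"
      unfolding arg_tl by (rule rfp_not[OF rfp_eq[OF f rf_arg]]) simp
    show "\<exists>n. of_bool (f n \<noteq> arg 0 xs) = (0 :: nat)" for xs
      using surjD[OF bij_is_surj[OF assms(2)], of "arg 0 xs"] by auto
  qed
  moreover have "(LEAST n. of_bool (f n \<noteq> y) = (0 :: nat)) = inv f y" for y
    using assms(2) by (intro Least_equality) (auto simp: bij_is_surj surj_f_inv_f bij_is_inj
        inv_f_f)
  ultimately show ?thesis by (simp add: computable_iff)
qed

text \<open>One value is patched at a time: resetting \<open>h\<close> at \<open>K\<close> leaves a
  function that is the identity from \<open>K\<close> on.\<close>

lemma computable_finite_support: "\<forall>x\<ge>K. h x = x \<Longrightarrow> computable h"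
proof (induction K arbitrary: h)
  case 0
  then have "h = (\<lambda>x. x)" by auto
  then show ?case by (simp add: computable_iff rf_arg)
next
  case (Suc K)
  have "computable (h(K := K))" using Suc by (auto simp: Suc_le_eq)
  then have "rf (Suc 0) (\<lambda>xs. if arg 0 xs = K then h K else (h(K := K)) (arg 0 xs))"
    unfolding computable_iff by (intro rf_if rfp_eq rf_const rf_arg) simp_all
  then show ?case unfolding computable_iff by (rule rf_cong) simp
qed

lemma one_equiv_refl: "one_equiv A A"
  unfolding one_equiv_def using computable_finite_support[of 0 id] by (intro exI[of _ id]) auto

lemma one_equiv_sym: "one_equiv A B \<Longrightarrow> one_equiv B A"
  unfolding one_equiv_def
  by (metis bij_imp_bij_inv bij_is_surj computable_inv surj_f_inv_f)

lemma one_equiv_trans: "one_equiv A B \<Longrightarrow> one_equiv B C \<Longrightarrow> one_equiv A C"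
  unfolding one_equiv_def by (metis bij_comp comp_apply computable_comp)

text \<open>Equal cardinalities below \<open>K\<close> give bijections between the members and
  between the non-members there. Glued with the identity from \<open>K\<close> on, they form a
  permutation of finite support.\<close>

lemma one_equiv_finite_change:
  assumes "card ({..<K} \<inter> B) = card ({..<K} \<inter> B')" "\<forall>y\<ge>K. y \<in> B \<longleftrightarrow> y \<in> B'"
  shows "one_equiv B B'"
proof -
  obtain h1 where h1: "bij_betw h1 ({..<K} \<inter> B) ({..<K} \<inter> B')"
    using assms(1) by (metis finite_Int finite_lessThan finite_same_card_bij)
  have "card ({..<K} - B) = card ({..<K} - B')"
    using assms(1) by (simp add: card_Diff_subset_Int)
  then obtain h2 where h2: "bij_betw h2 ({..<K} - B) ({..<K} - B')"
    by (metis finite_Diff finite_lessThan finite_same_card_bij)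
  let ?h = "\<lambda>x. if x < K then if x \<in> B then h1 x else h2 x else x"
  have "bij_betw ?h ({..<K} \<inter> B) ({..<K} \<inter> B')"
    using h1 by (rule bij_betw_cong[THEN iffD1, rotated]) auto
  moreover have "bij_betw ?h ({..<K} - B) ({..<K} - B')"
    using h2 by (rule bij_betw_cong[THEN iffD1, rotated]) auto
  moreover have "bij_betw ?h {K..} {K..}"
    using bij_betw_id by (rule bij_betw_cong[THEN iffD1, rotated]) auto
  ultimately have "bij_betw ?h ({..<K} \<inter> B \<union> ({..<K} - B) \<union> {K..}) ({..<K} \<inter> B' \<union> ({..<K} - B') \<union>
      {K..})"
    by (intro bij_betw_combine) auto
  moreover have "{..<K} \<inter> X \<union> ({..<K} - X) \<union> {K..} = UNIV" for X by auto
  ultimately have "bij ?h" by simp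
  moreover have "x \<in> B \<longleftrightarrow> ?h x \<in> B'" for x
    using assms(2) bij_betwE[OF h1] bij_betwE[OF h2] by auto
  moreover have "computable ?h" by (rule computable_finite_support[of K]) auto
  ultimately show ?thesis unfolding one_equiv_def by blast
qed

lemma one_equiv_nontrivial:
  assumes "one_equiv A B" "A \<noteq> {}" "A \<noteq> UNIV"
  shows "B \<noteq> {}" "B \<noteq> UNIV"
  using assms unfolding one_equiv_def by (auto dest: bij_is_surj)

text \<open>Each of \<open>{}\<close> and \<open>UNIV\<close> is alone in its class, so only sets
  possessing a first change need edges.\<close>

lemma one_equiv_trivial:
  assumes "one_equiv A B" "A \<noteq> B"
  shows "A \<noteq> {}" "A \<noteq> UNIV"
  using assms unfolding one_equiv_def by (auto dest!: bij_is_surj) (metis surjD)+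

section \<open>The edge relation\<close>

definition first_change :: "nat set \<Rightarrow> nat \<Rightarrow> bool" where
  "first_change A k \<longleftrightarrow> \<not> (k \<in> A \<longleftrightarrow> 0 \<in> A) \<and> (\<forall>i<k. i \<in> A \<longleftrightarrow> 0 \<in> A)"

lemma first_change_unique: "first_change A k \<Longrightarrow> first_change A l \<Longrightarrow> k = l"
  unfolding first_change_def by (metis linorder_neqE_nat)

lemma first_change_ex:
  assumes "A \<noteq> {}" "A \<noteq> UNIV"
  shows "\<exists>k. first_change A k"
proof -
  have "\<exists>k. \<not> (k \<in> A \<longleftrightarrow> 0 \<in> A)" using assms by auto
  then show ?thesis
    unfolding first_change_def by (subst (asm) exists_least_iff) auto
qed

definition runs :: "nat \<Rightarrow> nat \<Rightarrow> nat \<Rightarrow> bool" where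
  "runs e x y \<longleftrightarrow> (\<exists>s. eval_within s e x y)"

lemma runs_eval: "runs e x y \<Longrightarrow> eval (dec e) [x] y"
  unfolding runs_def using eval_within_sound by blast

lemma runs_enc: "eval c [x] y \<Longrightarrow> runs (enc c) x y"
  unfolding runs_def by (rule eval_within_complete)

lemma runs_functional: "runs e x y \<Longrightarrow> runs e x z \<Longrightarrow> y = z"
  using runs_eval eval_functional by blast

definition splice :: "nat \<Rightarrow> nat set \<Rightarrow> nat set \<Rightarrow> nat set" where
  "splice n D B = {y. if y < n then y \<in> D else y \<in> B}"

text \<open>The rearrangement is recorded only by its result, the set coded by \<open>d\<close>;
  equal cardinality guarantees that a permutation exists. The bound on \<open>d\<close> admits every
  subset of \<open>{..<2 * k}\<close>. The relation is directed towards the larger first change and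
  is symmetrized later.\<close>

definition edge :: "nat set \<Rightarrow> nat set \<Rightarrow> bool" where
  "edge A B \<longleftrightarrow> (\<exists>k l. first_change B k \<and> first_change A l \<and> l < k \<and>
    (\<exists>e\<le>k. \<exists>d<2 ^ (2 * k).
      card ({..<2 * k} \<inter> set_decode d) = card ({..<2 * k} \<inter> B) \<and>
      (\<exists>f. bij f \<and> (\<forall>x. runs e x (f x)) \<and> (\<forall>x. x \<in> A \<longleftrightarrow> f x \<in> splice (2 * k) (set_decode d) B))))"

lemma edge_one_equiv: "edge A B \<Longrightarrow> one_equiv A B"
proof -
  assume "edge A B"
  then obtain k e d f where
    card: "card ({..<2 * k} \<inter> set_decode d) = card ({..<2 * k} \<inter> B)"
    and f: "bij f" "\<forall>x. runs e x (f x)" "\<forall>x. x \<in> A \<longleftrightarrow> f x \<in> splice (2 * k) (set_decode d) B"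
    unfolding edge_def by blast
  have "computable f" unfolding computable_def using f(2) runs_eval by blast
  with f have "one_equiv A (splice (2 * k) (set_decode d) B)" unfolding one_equiv_def by blast
  moreover have "{..<2 * k} \<inter> splice (2 * k) (set_decode d) B = {..<2 * k} \<inter> set_decode d"
    by (auto simp: splice_def)
  then have "one_equiv (splice (2 * k) (set_decode d) B) B"
    using card by (intro one_equiv_finite_change[of "2 * k"]) (auto simp: splice_def)
  ultimately show ?thesis by (rule one_equiv_trans)
qed

lemma set_encode_less: "S \<subseteq> {..<n} \<Longrightarrow> set_encode S < 2 ^ n"
proof -
  assume "S \<subseteq> {..<n}"
  then have "set_encode S \<le> set_encode {..<n}" unfolding set_encode_def by (intro sum_mono2) auto
  also have "\<dots> < 2 ^ n" unfolding set_encode_def by (induction n) (auto simp: lessThan_Suc)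
  finally show ?thesis .
qed

text \<open>Here \<open>C\<close> is the set \<open>B\<close> before its rearrangement, and the
  required \<open>d\<close> codes the part of \<open>C\<close> below \<open>2 * k\<close>.\<close>

lemma edgeI:
  assumes "first_change B k" "first_change A l" "l < k" "enc c \<le> k"
    and "bij f" "\<forall>x. eval c [x] (f x)" "\<forall>x. x \<in> A \<longleftrightarrow> f x \<in> C"
    and "card ({..<2 * k} \<inter> C) = card ({..<2 * k} \<inter> B)" "\<forall>y\<ge>2 * k. y \<in> C \<longleftrightarrow> y \<in> B"
  shows "edge A B"
proof -
  let ?d = "set_encode ({..<2 * k} \<inter> C)"
  have "?d < 2 ^ (2 * k)" by (rule set_encode_less) auto
  moreover have "set_decode ?d = {..<2 * k} \<inter> C" by simp
  moreover have "splice (2 * k) ({..<2 * k} \<inter> C) B = C"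
    using assms(9) by (auto simp: splice_def)
  moreover have "card ({..<2 * k} \<inter> ({..<2 * k} \<inter> C)) = card ({..<2 * k} \<inter> B)"
    using assms(8) by (simp flip: Int_assoc)
  moreover have "\<forall>x. runs (enc c) x (f x)" using assms(6) runs_enc by blast
  ultimately show ?thesis
    unfolding edge_def using assms(1-5,7)
    by (intro exI[of _ k] exI[of _ l] conjI exI[of _ "enc c"] exI[of _ ?d] exI[of _ f]) simp_all
qed

lemma constant_prefix:
  obtains B where "card ({..<2 * N} \<inter> B) = card ({..<2 * N} \<inter> C)" "\<forall>y\<ge>2 * N. y \<in> B \<longleftrightarrow> y \<in> C"
    "\<forall>i<N. i \<in> B \<longleftrightarrow> (0 :: nat) \<in> B"
proof -
  define n where "n = card ({..<2 * N} \<inter> C)"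
  have n: "n \<le> 2 * N" unfolding n_def using card_mono[of "{..<2 * N}" "{..<2 * N} \<inter> C"] by simp
  \<comment> \<open>At most \<open>N\<close> elements fit into the upper half and leave the lower
    half empty; more than \<open>N\<close>, packed from 0 upwards, fill the lower half.\<close>
  define T where "T = (if n \<le> N then {2 * N - n..<2 * N} else {..<n})"
  have T: "T \<subseteq> {..<2 * N}" "card T = n" "\<forall>i<N. i \<in> T \<longleftrightarrow> 0 \<in> T"
    unfolding T_def using n by auto
  let ?B = "T \<union> (C - {..<2 * N})"
  have eq: "{..<2 * N} \<inter> ?B = T" using T(1) by auto
  show ?thesis
  proof (rule that[of ?B])
    show "card ({..<2 * N} \<inter> ?B) = card ({..<2 * N} \<inter> C)" unfolding eq using T(2) n_def by simp
    show "\<forall>y\<ge>2 * N. y \<in> ?B \<longleftrightarrow> y \<in> C" using T(1) by auto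
    have "i \<in> ?B \<longleftrightarrow> i \<in> T" if "i < N" for i using that by auto
    then show "\<forall>i<N. i \<in> ?B \<longleftrightarrow> 0 \<in> ?B" using T(3) by (metis gr_zeroI not_less0)
  qed
qed

text \<open>The rearrangement is made below \<open>2 * N\<close>, whereas \<open>edge\<close>
  compares cardinalities below \<open>2 * k\<close> for the later number \<open>k\<close>.\<close>

lemma card_Int_lessThan_extend:
  assumes "card ({..<m} \<inter> B) = card ({..<m} \<inter> C)" "\<forall>y\<ge>m. y \<in> B \<longleftrightarrow> y \<in> C" "m \<le> n"
  shows "card ({..<n} \<inter> B) = card ({..<n} \<inter> (C :: nat set))"
proof -
  have "{..<n} \<inter> X = ({..<m} \<inter> X) \<union> ({m..<n} \<inter> X)" for X :: "nat set" using assms(3) by auto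
  then have "card ({..<n} \<inter> X) = card ({..<m} \<inter> X) + card ({m..<n} \<inter> X)" for X :: "nat set"
    by (simp add: card_Un_disjoint disjoint_iff)
  moreover have "{m..<n} \<inter> B = {m..<n} \<inter> C" using assms(2) by auto
  ultimately show ?thesis using assms(1) by simp
qed

lemma one_equiv_common_neighbour:
  assumes AC: "one_equiv A C" "A \<noteq> C"
  shows "\<exists>B. edge A B \<and> edge C B"
proof -
  obtain f c where f: "\<forall>x. eval c [x] (f x)" "bij f" "\<forall>n. n \<in> A \<longleftrightarrow> f n \<in> C"
    using AC(1) unfolding one_equiv_def computable_def by blast
  have A: "A \<noteq> {}" "A \<noteq> UNIV" using one_equiv_trivial[OF AC] by auto
  have C: "C \<noteq> {}" "C \<noteq> UNIV" using one_equiv_nontrivial[OF AC(1) A] by auto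
  obtain l l' where l: "first_change A l" "first_change C l'"
    using A C first_change_ex by metis
  \<comment> \<open>\<open>N\<close> exceeds both first changes and the codes of both programs used:
    \<open>c\<close> for \<open>A\<close>, and the identity \<open>Proj 0\<close> for
    \<open>C\<close>.\<close>
  define N where "N = Suc (l + l' + enc c + enc (Proj 0))"
  obtain B where B: "card ({..<2 * N} \<inter> B) = card ({..<2 * N} \<inter> C)"
    "\<forall>y\<ge>2 * N. y \<in> B \<longleftrightarrow> y \<in> C" "\<forall>i<N. i \<in> B \<longleftrightarrow> 0 \<in> B"
    by (rule constant_prefix)
  have "one_equiv C B" using one_equiv_finite_change[of "2 * N" C B] B by simp
  then obtain k where k: "first_change B k"
    using one_equiv_nontrivial[OF _ C] first_change_ex by metis
  \<comment> \<open>A set constant below \<open>N\<close> cannot change before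
    \<open>N\<close>.\<close>
  then have Nk: "N \<le> k" using B(3) unfolding first_change_def by (meson not_le)
  have card: "card ({..<2 * k} \<inter> C) = card ({..<2 * k} \<inter> B)"
    using card_Int_lessThan_extend[OF B(1,2), of "2 * k"] Nk by simp
  have out: "\<forall>y\<ge>2 * k. y \<in> C \<longleftrightarrow> y \<in> B" using B(2) Nk by auto
  have "edge A B" by (rule edgeI[OF k l(1) _ _ f(2,1,3) card out]) (use Nk N_def in auto)
  moreover have "edge C B"
    by (rule edgeI[OF k l(2) _ _ bij_id, of "Proj 0" C])
      (use Nk N_def card out eval_Proj[of 0 "[x]" for x] in auto)
  ultimately show ?thesis by blast
qed

lemma one_equiv_01: "one_equiv {0} {1}"
proof (rule one_equiv_finite_change[of 2])
  have "{..<2} \<inter> {0} = {0 :: nat}" "{..<2} \<inter> {1} = {1 :: nat}" by auto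
  then show "card ({..<2} \<inter> {0 :: nat}) = card ({..<2} \<inter> {1 :: nat})" by simp
qed auto

text \<open>Both sets change first at 1, so the strict inequality in \<open>edge\<close> fails in
  both directions.\<close>

lemma not_edge_01: "\<not> edge {0} {1}" "\<not> edge {1} {0}"
proof -
  have "first_change {0} 1" "first_change {1} 1" by (auto simp: first_change_def)
  then show "\<not> edge {0} {1}" "\<not> edge {1} {0}"
    unfolding edge_def using first_change_unique by (metis less_not_refl)+
qed

section \<open>Arithmetical complexity of the graph\<close>

text \<open>Totality and surjectivity below \<open>n\<close> are searched for up to stage
  \<open>m\<close>. Correctness and injectivity concern only computations visible at stage
  \<open>n\<close>, so that conjunct is independent of \<open>m\<close>. Membership in the splice is
  spelled out for the closure rules.\<close>

definition edge_approx :: "nat \<Rightarrow> nat \<Rightarrow> nat \<Rightarrow> nat \<Rightarrow> nat \<Rightarrow> nat set \<Rightarrow> nat set \<Rightarrow> bool" where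
  "edge_approx n m e d k A B \<longleftrightarrow>
    (\<forall>i<n. (\<exists>y<m. eval_within m e i y) \<and> (\<exists>x<m. eval_within m e x i)) \<and>
    (\<forall>x<n. \<forall>y<n. eval_within n e x y \<longrightarrow>
      (x \<in> A \<longleftrightarrow> (y < 2 * k \<and> y \<in> set_decode d \<or> 2 * k \<le> y \<and> y \<in> B)) \<and>
      (\<forall>x'<n. eval_within n e x' y \<longrightarrow> x = x'))"

text \<open>The requirements \<open>k < m\<close>, \<open>2 * k \<le> m\<close> and
  \<open>n \<le> m\<close> ensure that prefixes of length \<open>m\<close> determine every bit of
  the two sets that is consulted. Cardinalities are written as sums to be visibly recursive.\<close>

definition edge_test :: "nat \<Rightarrow> nat \<Rightarrow> nat \<Rightarrow> nat \<Rightarrow> bool" where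
  "edge_test n m a b \<longleftrightarrow> (\<exists>k<m. \<exists>l<k. first_change (set_decode b) k \<and> first_change (set_decode a) l \<and>
    2 * k \<le> m \<and> n \<le> m \<and> (\<exists>e<Suc k. \<exists>d<2 ^ (2 * k).
      (\<Sum>i<2 * k. of_bool (i \<in> set_decode d) :: nat) = (\<Sum>i<2 * k. of_bool (i \<in> set_decode b)) \<and>
      edge_approx n m e d k (set_decode a) (set_decode b)))"

lemma rfp_edge_test:
  assumes "rf k f1" "rf k f2" "rf k f3" "rf k f4"
  shows "rfp k (\<lambda>xs. edge_test (f1 xs) (f2 xs) (f3 xs) (f4 xs))"
proof (rule rf_Comp4[where h = "\<lambda>n m a b. of_bool (edge_test n m a b)", OF _ assms])
  show "rfp (Suc (Suc (Suc (Suc 0)))) (\<lambda>xs. edge_test (arg 0 xs) (arg (Suc 0) xs) (arg (Suc (Suc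
      0)) xs)
      (arg (Suc (Suc (Suc 0))) xs))"
    unfolding edge_test_def edge_approx_def first_change_def
    by (rule rf_intros rfp_eval_within rf_sum | (rule rf_arg, simp; fail) | simp only: arg_tl)+
qed

lemma set_decode_prefix_code: "set_decode (prefix_code A m) = A \<inter> {..<m}"
proof -
  have "prefix_code A m = set_encode (A \<inter> {..<m})"
    unfolding prefix_code_def set_encode_def by (rule sum.cong) auto
  then show ?thesis by simp
qed

lemma first_change_Int: "k < m \<Longrightarrow> first_change (A \<inter> {..<m}) k \<longleftrightarrow> first_change A k"
  unfolding first_change_def by auto

lemma sum_of_bool_lessThan: "(\<Sum>i<(n :: nat). of_bool (i \<in> S) :: nat) = card ({..<n} \<inter> S)"
  by (induction n) (auto simp: lessThan_Suc)

lemma edge_approx_Int: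
  assumes "n \<le> m"
  shows "edge_approx n m e d k (A \<inter> {..<m}) (B \<inter> {..<m}) \<longleftrightarrow> edge_approx n m e d k A B"
proof -
  have "x \<in> X \<inter> {..<m} \<longleftrightarrow> x \<in> X" if "x < n" for x X using that assms by auto
  then show ?thesis unfolding edge_approx_def by (simp cong: conj_cong)
qed

lemma edge_test_prefix_code:
  "edge_test n m (prefix_code A m) (prefix_code B m) \<longleftrightarrow>
    (\<exists>k<m. \<exists>l<k. first_change B k \<and> first_change A l \<and> 2 * k \<le> m \<and> n \<le> m \<and>
      (\<exists>e\<le>k. \<exists>d<2 ^ (2 * k). card ({..<2 * k} \<inter> set_decode d) = card ({..<2 * k} \<inter> B) \<and>
        edge_approx n m e d k A B))"
proof -
  have "{..<2 * k} \<inter> (B \<inter> {..<m}) = {..<2 * k} \<inter> B" if "2 * k \<le> m" for k using that by auto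
  then show ?thesis
    unfolding edge_test_def set_decode_prefix_code sum_of_bool_lessThan less_Suc_eq_le
    by (simp add: first_change_Int edge_approx_Int cong: conj_cong)
qed

section \<open>From approximations to edges and back\<close>

lemma edge_approx_antimono:
  "edge_approx n m e d k A B \<Longrightarrow> n' \<le> n \<Longrightarrow> edge_approx n' m e d k A B"
  unfolding edge_approx_def by (meson eval_within_mono order.strict_trans2)

lemma common_bound:
  assumes "\<forall>i<n. \<exists>m. P m i" "\<And>i m m'. P m i \<Longrightarrow> m \<le> m' \<Longrightarrow> P m' i"
  shows "\<exists>m. \<forall>i<(n :: nat). P (m :: nat) i"
  using assms(1)
proof (induction n)
  case (Suc n)
  then obtain m m' where "\<forall>i<n. P m i" "P m' n" by auto
  then have "\<forall>i<Suc n. P (max m m') i" using assms(2) by (auto simp: less_Suc_eq)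
  then show ?case by blast
qed simp

text \<open>The lower bound \<open>M\<close> lets the caller also meet the size conditions of
  \<open>edge_test\<close>.\<close>

lemma edge_approx_complete:
  assumes f: "bij f" "\<forall>x. runs e x (f x)" "\<forall>x. x \<in> A \<longleftrightarrow> f x \<in> splice (2 * k) (set_decode d) B"
  shows "\<exists>m\<ge>M. edge_approx n m e d k A B"
proof -
  let ?P = "\<lambda>m i. (\<exists>y<m. eval_within m e i y) \<and> (\<exists>x<m. eval_within m e x i)"
  have mono: "?P m i \<Longrightarrow> m \<le> m' \<Longrightarrow> ?P m' i" for i m m'
    by (meson eval_within_mono order.strict_trans2)
  have "\<exists>m. ?P m i" for i
  proof -
    obtain x where x: "f x = i" using f(1) by (metis bij_is_surj surjD)
    obtain s s' where s: "eval_within s e i (f i)" "eval_within s' e x i"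
      using f(2) x unfolding runs_def by metis
    let ?m = "Suc (max (max s s') (max x (f i)))"
    have "f i < ?m" "x < ?m" "s \<le> ?m" "s' \<le> ?m" by auto
    then have "?P ?m i" using s eval_within_mono by blast
    then show ?thesis by blast
  qed
  with common_bound[of n ?P] mono obtain m where m: "\<forall>i<n. ?P m i" by blast
  have fun_eq: "y = f x" if "eval_within s e x y" for s x y
    using that f(2) runs_functional unfolding runs_def by metis
  have "edge_approx n (max m M) e d k A B"
    unfolding edge_approx_def
  proof (intro conjI allI impI)
    fix i assume "i < n"
    then have "?P (max m M) i" using m mono[of m i "max m M"] by auto
    then show "\<exists>y<max m M. eval_within (max m M) e i y" "\<exists>x<max m M. eval_within (max m M) e x i"
        by auto
  next
    fix x y assume "eval_within n e x y"
    then have y: "y = f x" by (rule fun_eq)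
    show "x \<in> A \<longleftrightarrow> (y < 2 * k \<and> y \<in> set_decode d \<or> 2 * k \<le> y \<and> y \<in> B)"
      using f(3) y by (auto simp: splice_def)
    show "x = x'" if "eval_within n e x' y" for x'
      using fun_eq[OF that] y f(1) by (metis bij_is_inj injD)
  qed
  then show ?thesis by (meson max.cobounded2)
qed

text \<open>Totality and surjectivity at \<open>i\<close> come from \<open>n = Suc i\<close>;
  correctness and injectivity come from an \<open>n\<close> beyond the stages, arguments and values
  of the computations compared.\<close>

lemma edge_approx_sound:
  assumes "\<forall>n. \<exists>m. edge_approx n m e d k A B"
  shows "\<exists>f. bij f \<and> (\<forall>x. runs e x (f x)) \<and> (\<forall>x. x \<in> A \<longleftrightarrow> f x \<in> splice (2 * k) (set_decode d) B)"
proof -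
  have total: "\<exists>y. runs e i y" "\<exists>x. runs e x i" for i
    using assms[rule_format, of "Suc i"] unfolding edge_approx_def runs_def by blast+
  then obtain f where f: "\<forall>x. runs e x (f x)" by metis
  have correct: "x \<in> A \<longleftrightarrow> y \<in> splice (2 * k) (set_decode d) B" if run: "runs e x y" for x y
  proof -
    obtain s where s: "eval_within s e x y" using run unfolding runs_def by blast
    define n where "n = Suc (s + x + y)"
    have "eval_within n e x y" using s by (rule eval_within_mono) (simp add: n_def)
    moreover obtain m where "edge_approx n m e d k A B" using assms by blast
    moreover have "x < n" "y < n" by (auto simp: n_def)
    ultimately have "x \<in> A \<longleftrightarrow> (y < 2 * k \<and> y \<in> set_decode d \<or> 2 * k \<le> y \<and> y \<in> B)"
      unfolding edge_approx_def by blast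
    then show ?thesis by (auto simp: splice_def)
  qed
  have inj: "x = x'" if run: "runs e x y" "runs e x' y" for x x' y
  proof -
    obtain s s' where s: "eval_within s e x y" "eval_within s' e x' y" using run
        unfolding runs_def by blast
    define n where "n = Suc (s + s' + x + x' + y)"
    have "eval_within n e x y" "eval_within n e x' y" using s
        by (auto elim!: eval_within_mono simp: n_def)
    moreover obtain m where "edge_approx n m e d k A B" using assms by blast
    moreover have "x < n" "x' < n" "y < n" by (auto simp: n_def)
    ultimately show ?thesis unfolding edge_approx_def by blast
  qed
  have "inj f" using inj f by (metis injI)
  moreover have "surj f" using total(2) f runs_functional by (metis surjI)
  ultimately show ?thesis using f correct by (metis bijI)
qed

text \<open>If each \<open>p\<close> failed at some \<open>g p\<close>, all would fail at the
  maximum of these numbers. This moves a bounded existential quantifier in front of the universal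
  one.\<close>

lemma finite_pigeonhole_antimono:
  assumes "finite F" "\<forall>n. \<exists>p\<in>F. P n p" "\<And>n n' p. P n p \<Longrightarrow> n' \<le> n \<Longrightarrow> P n' p"
  shows "\<exists>p\<in>F. \<forall>n :: nat. P n p"
proof (rule ccontr)
  assume "\<not> (\<exists>p\<in>F. \<forall>n. P n p)"
  then obtain g where g: "\<forall>p\<in>F. \<not> P (g p) p" by metis
  obtain p where p: "p \<in> F" "P (Max (g ` F)) p" using assms(2) by blast
  then have "P (g p) p" using assms(1,3) by (meson Max_ge finite_imageI imageI)
  with g p show False by blast
qed

lemma edge_iff_edge_test: "edge A B \<longleftrightarrow> (\<forall>n. \<exists>m. edge_test n m (prefix_code A m) (prefix_code B m))"
proof
  assume "edge A B"
  then obtain k l e d f where fc: "first_change B k" "first_change A l" "l < k" "e \<le> k"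
      "d < 2 ^ (2 * k)"
    and card: "card ({..<2 * k} \<inter> set_decode d) = card ({..<2 * k} \<inter> B)"
    and f: "bij f" "\<forall>x. runs e x (f x)" "\<forall>x. x \<in> A \<longleftrightarrow> f x \<in> splice (2 * k) (set_decode d) B"
    unfolding edge_def by blast
  show "\<forall>n. \<exists>m. edge_test n m (prefix_code A m) (prefix_code B m)"
  proof
    fix n
    obtain m where m: "Suc (2 * k + n) \<le> m" "edge_approx n m e d k A B"
      using edge_approx_complete[OF f] by blast
    then have "k < m" "2 * k \<le> m" "n \<le> m" by auto
    with m fc card show "\<exists>m. edge_test n m (prefix_code A m) (prefix_code B m)"
      unfolding edge_test_prefix_code by blast
  qed
next
  assume *: "\<forall>n. \<exists>m. edge_test n m (prefix_code A m) (prefix_code B m)"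
  then obtain k l where kl: "first_change B k" "first_change A l" "l < k"
    unfolding edge_test_prefix_code by blast
  let ?F = "{(e, d). e \<le> k \<and> d < 2 ^ (2 * k) \<and> card ({..<2 * k} \<inter> set_decode d) =
      card ({..<2 * k} \<inter> B)}"
  let ?P = "\<lambda>n p. \<exists>m. edge_approx n m (fst p) (snd p) k A B"
  \<comment> \<open>Uniqueness of the first change fixes \<open>k\<close> for all \<open>n\<close>;
    only the pair \<open>(e, d)\<close> could vary with \<open>n\<close>, and it ranges over a
    finite set.\<close>
  have "\<exists>p\<in>?F. \<forall>n. ?P n p"
  proof (rule finite_pigeonhole_antimono)
    show "finite ?F" by (rule finite_subset[of _ "{..k} \<times> {..<2 ^ (2 * k)}"]) auto
    show "\<forall>n. \<exists>p\<in>?F. ?P n p"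
    proof
      fix n
      obtain m k' e d where "first_change B k'" "e \<le> k'" "d < 2 ^ (2 * k')"
        "card ({..<2 * k'} \<inter> set_decode d) = card ({..<2 * k'} \<inter> B)" "edge_approx n m e d k' A B"
        using * unfolding edge_test_prefix_code by blast
      moreover from this have "k' = k" using kl first_change_unique by blast
      ultimately show "\<exists>p\<in>?F. ?P n p" by (intro bexI[of _ "(e, d)"]) auto
    qed
    show "?P n p \<Longrightarrow> n' \<le> n \<Longrightarrow> ?P n' p" for n n' p using edge_approx_antimono by blast
  qed
  then obtain e d where "e \<le> k" "d < 2 ^ (2 * k)"
    "card ({..<2 * k} \<inter> set_decode d) = card ({..<2 * k} \<inter> B)" "\<forall>n. \<exists>m. edge_approx n m e d k A B"
    by auto
  then show "edge A B" unfolding edge_def using kl edge_approx_sound[of e d k A B] by blast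
qed

text \<open>A success in one direction excludes every success in the other, at all \<open>n\<close>
  and \<open>m\<close>. Hence a disjunction of tests cannot be satisfied by mixing directions, and
  the symmetrized graph stays in \<open>Pi02\<close>.\<close>

lemma edge_test_asym:
  "edge_test n m (prefix_code A m) (prefix_code B m) \<Longrightarrow>
    \<not> edge_test n' m' (prefix_code B m') (prefix_code A m')"
  unfolding edge_test_prefix_code by (metis first_change_unique less_asym)

lemma Pi02_edge: "Pi02 {(A, B). edge A B \<or> edge B A}"
  unfolding Pi02_def
proof (intro exI conjI)
  let ?R = "\<lambda>n m a b. edge_test n m a b \<or> edge_test n m b a"
  have "rfp 4 (\<lambda>xs. ?R (arg 0 xs) (arg 1 xs) (arg 2 xs) (arg 3 xs))"
    by (intro rfp_or rfp_edge_test rf_arg) auto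
  then obtain c where c: "\<And>xs. length xs = 4 \<Longrightarrow>
      eval c xs (of_bool (?R (arg 0 xs) (arg 1 xs) (arg 2 xs) (arg 3 xs)))"
    unfolding rf_def by blast
  have "eval c [n, m, a, b] (if ?R n m a b then 1 else 0)" for n m a b
    using c[of "[n, m, a, b]"] by (simp add: of_bool_def numeral_2_eq_2 numeral_3_eq_3)
  then show "computable_rel4 ?R" unfolding computable_rel4_def by blast
  show "{(A, B). edge A B \<or> edge B A} =
      {(A, B). \<forall>n. \<exists>m. ?R n m (prefix_code A m) (prefix_code B m)}"
    unfolding edge_iff_edge_test using edge_test_asym by blast
qed

section \<open>Connected components and diameter\<close>

theorem theorem4p1:
  shows "Pi02_graphable_with_diameter {(A, B). one_equiv A B} 2"
proof -
  let ?G = "{(A, B). edge A B \<or> edge B A}"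
  have "\<not> edge A A" for A unfolding edge_def using first_change_unique by (metis less_not_refl)
  then have simple: "simple_graph ?G" unfolding simple_graph_def sym_def irrefl_def by auto
  have "one_equiv A B" if "(A, B) \<in> ?G\<^sup>*" for A B
    using that
  proof induction
    case base
    show ?case by (rule one_equiv_refl)
  next
    case (step B C)
    then have "one_equiv B C" using edge_one_equiv one_equiv_sym by blast
    with step.IH show ?case by (rule one_equiv_trans)
  qed
  moreover have short: "A = C \<or> (A, C) \<in> ?G ^^ 2" if AC: "one_equiv A C" for A C
  proof (cases "A = C")
    case False
    then obtain B where "edge A B" "edge C B" using one_equiv_common_neighbour[OF AC] by blast
    then have "(A, B) \<in> ?G" "(B, C) \<in> ?G" by auto
    then show ?thesis by (auto simp: numeral_2_eq_2)
  qed simp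
  moreover have "(A, C) \<in> ?G\<^sup>*" if "one_equiv A C" for A C
    using short[OF that] relpow_imp_rtrancl by blast
  ultimately have star: "?G\<^sup>* = {(A, B). one_equiv A B}" by auto
  have "paths_bounded_by ?G 2"
    unfolding paths_bounded_by_def
  proof (intro allI impI)
    fix A C assume "(A, C) \<in> ?G\<^sup>*"
    then have "A = C \<or> (A, C) \<in> ?G ^^ 2" unfolding star using short by simp
    then show "\<exists>j\<le>2. (A, C) \<in> ?G ^^ j"
    proof
      assume "A = C"
      then show ?thesis by (intro exI[of _ 0]) simp
    qed blast
  qed
  \<comment> \<open>The sets \<open>{0}\<close> and \<open>{1}\<close> are connected, but they are
    distinct and not adjacent, which excludes paths of length 0 and 1.\<close>
  moreover have "\<not> paths_bounded_by ?G j" if "j < 2" for j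
  proof
    assume "paths_bounded_by ?G j"
    then obtain i where "i \<le> j" and i: "({0}, {1}) \<in> ?G ^^ i"
      unfolding paths_bounded_by_def star using one_equiv_01 by blast
    with \<open>j < 2\<close> have "i = 0 \<or> i = 1" by auto
    then show False using i not_edge_01 by auto
  qed
  ultimately have "has_diameter ?G 2" unfolding has_diameter_def by blast
  with Pi02_edge simple star show ?thesis unfolding Pi02_graphable_with_diameter_def by blast
qed

end
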